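(* Let $G=(S,T;E)$ with $S=\{s_1,\dots,s_n\}$, $T=\{t_1,\dots,t_k\}$ and $d\in\mathbb Z_+$. Consider the algorithm $S$-Greedy: start with $M=\emptyset$; for $i=1,\dots,n$, if there is an edge $s_it_j\in E$ such that $M\cup\{s_it_j\}$ is a $d$-distance matching, add to $M$ such an edge with the smallest index $j$; output $M$. Then the output $M$ is a $d$-distance matching with $2|M|\ge|M^*|$ for every $d$-distance matching $M^*$ of $G$; i.e., $S$-Greedy is a $2$-approximation algorithm for the maximum-cardinality $d$-distance matching problem.
   Context: $G$ is a finite bipartite graph without loops or parallel edges; the nodes of $S$ are in the fixed order $s_1,\dots,s_n$. A $d$-distance matching is a subset $M\subseteq E$ such that every node of $S$ is incident to at most one edge of $M$, and whenever $s_it,s_jt\in M$ with $i\ne j$, $t\in T$, we have $|j-i|\ge d$. *)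

theory Defs
  imports Main
begin

text \<open>
  A finite simple bipartite graph whose classes are enumerated without repetition as
  \<open>s 1, \<dots>, s n\<close> and \<open>t 1, \<dots>, t k\<close>. The edge between \<open>u\<close> in the first class and \<open>v\<close> in
  the second one is the pair \<open>(u, v)\<close>, and \<open>E\<close> is a set; so there are no loops and no parallel
  edges, and the two classes are disjoint, having separate types (when these types are
  instantiated to the same one, the position in the pair tells the classes apart).
\<close>

definition ordered_bipartite_graph ::
    "nat \<Rightarrow> (nat \<Rightarrow> 'a) \<Rightarrow> nat \<Rightarrow> (nat \<Rightarrow> 'b) \<Rightarrow> ('a \<times> 'b) set \<Rightarrow> bool" where
  "ordered_bipartite_graph n s k t E \<longleftrightarrow>
     inj_on s {1..n} \<and> inj_on t {1..k} \<and> E \<subseteq> s ` {1..n} \<times> t ` {1..k}"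

text \<open>
  The class \<open>T\<close> is not a parameter here: the common endpoint \<open>v\<close> of two edges of \<open>M \<subseteq> E\<close> lies in
  \<open>T\<close> anyway. The distance is taken in \<^typ>\<open>int\<close>, since subtraction truncates on \<^typ>\<open>nat\<close>.
\<close>

definition distance_matching ::
    "nat \<Rightarrow> (nat \<Rightarrow> 'a) \<Rightarrow> ('a \<times> 'b) set \<Rightarrow> nat \<Rightarrow> ('a \<times> 'b) set \<Rightarrow> bool" where
  "distance_matching n s E d M \<longleftrightarrow>
     M \<subseteq> E \<and>
     (\<forall>u \<in> s ` {1..n}. card {e \<in> M. fst e = u} \<le> 1) \<and>
     (\<forall>i \<in> {1..n}. \<forall>j \<in> {1..n}. \<forall>v.
        i \<noteq> j \<and> (s i, v) \<in> M \<and> (s j, v) \<in> M \<longrightarrow> \<bar>int j - int i\<bar> \<ge> int d)"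

definition greedy_candidates ::
    "nat \<Rightarrow> (nat \<Rightarrow> 'a) \<Rightarrow> nat \<Rightarrow> (nat \<Rightarrow> 'b) \<Rightarrow> ('a \<times> 'b) set \<Rightarrow> nat \<Rightarrow> ('a \<times> 'b) set \<Rightarrow> nat \<Rightarrow> nat set"
  where
  "greedy_candidates n s k t E d M i =
     {j \<in> {1..k}. (s i, t j) \<in> E \<and> distance_matching n s E d (M \<union> {(s i, t j)})}"

definition greedy_step ::
    "nat \<Rightarrow> (nat \<Rightarrow> 'a) \<Rightarrow> nat \<Rightarrow> (nat \<Rightarrow> 'b) \<Rightarrow> ('a \<times> 'b) set \<Rightarrow> nat \<Rightarrow> nat \<Rightarrow> ('a \<times> 'b) set \<Rightarrow> ('a \<times> 'b) set"
  where
  "greedy_step n s k t E d i M =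
     (let C = greedy_candidates n s k t E d M i
      in if C \<noteq> {} then M \<union> {(s i, t (Min C))} else M)"

definition s_greedy ::
    "nat \<Rightarrow> (nat \<Rightarrow> 'a) \<Rightarrow> nat \<Rightarrow> (nat \<Rightarrow> 'b) \<Rightarrow> ('a \<times> 'b) set \<Rightarrow> nat \<Rightarrow> ('a \<times> 'b) set" where
  "s_greedy n s k t E d = fold (greedy_step n s k t E d) [1..<Suc n] {}"

end

theory Submission
  imports Defs
begin

text \<open>
  Let \<open>M\<close> be the greedy output and \<open>M'\<close> any distance matching. An edge of \<open>M'\<close> whose first
  endpoint \<open>s i\<close> is covered by \<open>M\<close> is charged to the edge of \<open>M\<close> at \<open>s i\<close>. If \<open>s i\<close> is uncovered,
  an edge \<open>(s i, v)\<close> of \<open>M'\<close> was rejected at step \<open>i\<close> because of some \<open>(s l, v)\<close> in \<open>M\<close> with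
  \<open>l < i < l + d\<close>, to which it is charged; two edges \<open>(s i, v)\<close> and \<open>(s j, v)\<close> charged in this way
  to the same edge satisfy \<open>\<bar>i - j\<bar> < d\<close>, hence coincide. Thus each edge of \<open>M\<close> is charged at
  most once in each of the two ways.
\<close>

lemma distance_matching_iff:
  assumes "ordered_bipartite_graph n s k t E"
  shows "distance_matching n s E d M \<longleftrightarrow>
    M \<subseteq> E \<and> (\<forall>u v w. (u, v) \<in> M \<and> (u, w) \<in> M \<longrightarrow> v = w) \<and>
    (\<forall>i \<in> {1..n}. \<forall>j \<in> {1..n}. \<forall>v. i < j \<and> (s i, v) \<in> M \<and> (s j, v) \<in> M \<longrightarrow> i + d \<le> j)"
    (is "_ \<longleftrightarrow> ?sub \<and> ?uniq \<and> ?dist")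
proof (cases "M \<subseteq> E")
  case True
  have E: "E \<subseteq> s ` {1..n} \<times> t ` {1..k}"
    using assms by (simp add: ordered_bipartite_graph_def)
  then have "finite M"
    using True by (meson finite_SigmaI finite_atLeastAtMost finite_imageI finite_subset)
  then have card_iff:
    "card {e \<in> M. fst e = u} \<le> 1 \<longleftrightarrow> (\<forall>v w. (u, v) \<in> M \<and> (u, w) \<in> M \<longrightarrow> v = w)" for u
    by (auto simp: card_le_Suc0_iff_eq)
  have "u \<in> s ` {1..n}" if "(u, v) \<in> M" for u v
    using that True E by auto
  then have uniq: "(\<forall>u \<in> s ` {1..n}. card {e \<in> M. fst e = u} \<le> 1) \<longleftrightarrow> ?uniq"
    unfolding card_iff by blast
  have "(\<forall>i \<in> {1..n}. \<forall>j \<in> {1..n}. \<forall>v.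
        i \<noteq> j \<and> (s i, v) \<in> M \<and> (s j, v) \<in> M \<longrightarrow> \<bar>int j - int i\<bar> \<ge> int d) \<longleftrightarrow> ?dist"
    (is "?L \<longleftrightarrow> _")
  proof
    assume ?L
    show ?dist
    proof (intro ballI allI impI)
      fix i j v
      assume "i \<in> {1..n}" "j \<in> {1..n}" and *: "i < j \<and> (s i, v) \<in> M \<and> (s j, v) \<in> M"
      then have "\<bar>int j - int i\<bar> \<ge> int d"
        using \<open>?L\<close> by (metis nat_neq_iff)
      then show "i + d \<le> j"
        using * by linarith
    qed
  next
    assume D: ?dist
    show ?L
    proof (intro ballI allI impI)
      fix i j v
      assume *: "i \<in> {1..n}" "j \<in> {1..n}" "i \<noteq> j \<and> (s i, v) \<in> M \<and> (s j, v) \<in> M"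
      then have "i < j \<or> j < i"
        by (simp add: neq_iff)
      then have "i + d \<le> j \<or> j + d \<le> i"
        using * D by meson
      then show "\<bar>int j - int i\<bar> \<ge> int d"
        by linarith
    qed
  qed
  with uniq True show ?thesis
    by (simp add: distance_matching_def)
qed (simp add: distance_matching_def)

text \<open>Used in contrapositive form: it names the obstruction when an edge at \<open>s i\<close>
  is rejected. As \<open>M\<close> lives on nodes with index below \<open>i\<close>, the node
  \<open>s i\<close> is still free, and the new edge can only be the later one of a pair at
  \<open>v\<close>.\<close>

lemma distance_matching_insert:
  assumes G: "ordered_bipartite_graph n s k t E"
    and M: "distance_matching n s E d M" "M \<subseteq> s ` {1..<i} \<times> UNIV"
    and i: "i \<in> {1..n}" "(s i, v) \<in> E"
    and far: "\<And>l. l \<in> {1..<i} \<Longrightarrow> (s l, v) \<in> M \<Longrightarrow> l + d \<le> i"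
  shows "distance_matching n s E d (M \<union> {(s i, v)})"
proof -
  have inj: "inj_on s {1..n}"
    using G by (simp add: ordered_bipartite_graph_def)
  \<comment> \<open>The bound on \<open>M\<close> speaks of nodes; injectivity of \<open>s\<close>
    turns it into a bound on indices.\<close>
  have idx: "l < i" if l: "(s l, w) \<in> M" "l \<in> {1..n}" for l w
  proof -
    obtain l' where "l' \<in> {1..<i}" "s l = s l'"
      using subsetD[OF M(2) l(1)] by auto
    moreover from this have "l = l'"
      using inj_onD[OF inj, of l l'] l(2) i(1) by simp
    ultimately show ?thesis
      by simp
  qed
  have new: "l = i" if "s l = s i" "l \<in> {1..n}" for l
    using inj_onD[OF inj that(1)] that(2) i(1) by simp
  have free: "(s i, w) \<notin> M" for w
    using idx[of i w] i(1) by auto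
  have dm: "M \<subseteq> E" "\<And>u x y. (u, x) \<in> M \<Longrightarrow> (u, y) \<in> M \<Longrightarrow> x = y"
    "\<And>a b w. a \<in> {1..n} \<Longrightarrow> b \<in> {1..n} \<Longrightarrow> a < b \<Longrightarrow> (s a, w) \<in> M \<Longrightarrow> (s b, w) \<in> M \<Longrightarrow> a + d \<le> b"
    using M(1) unfolding distance_matching_iff[OF G] by blast+
  show ?thesis
    unfolding distance_matching_iff[OF G]
  proof (intro conjI ballI allI impI)
    show "M \<union> {(s i, v)} \<subseteq> E"
      using dm(1) i(2) by simp
  next
    fix u x y
    assume "(u, x) \<in> M \<union> {(s i, v)} \<and> (u, y) \<in> M \<union> {(s i, v)}"
    then show "x = y"
      using dm(2)[of u x y] free by auto
  next
    fix a b w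
    assume *: "a \<in> {1..n}" "b \<in> {1..n}"
      "a < b \<and> (s a, w) \<in> M \<union> {(s i, v)} \<and> (s b, w) \<in> M \<union> {(s i, v)}"
    then have "(s a, w) \<in> M \<or> a = i \<and> w = v" "(s b, w) \<in> M \<or> b = i \<and> w = v"
      using new[of a] new[of b] by auto
    \<comment> \<open>An old edge at \<open>s b\<close> would force \<open>b < i\<close>, against
      \<open>a < b\<close>.\<close>
    moreover have "\<not> (a = i \<and> (s b, w) \<in> M)"
      using * idx[of b w] by auto
    ultimately consider "(s a, w) \<in> M" "(s b, w) \<in> M" | "(s a, v) \<in> M" "w = v" "b = i"
      using * by blast
    then show "a + d \<le> b"
    proof cases
      case 1
      then show ?thesis
        using dm(3)[of a b w] * by simp
    next
      case 2
      then show ?thesis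
        using far[of a] * by simp
    qed
  qed
qed

text \<open>The last claim holds because either a candidate exists and \<open>s i\<close> gets
  covered, or the edge to \<open>v\<close> itself fails to extend \<open>M\<close>, so an earlier
  edge at \<open>v\<close> is too close.\<close>

lemma greedy_step_props:
  assumes G: "ordered_bipartite_graph n s k t E"
    and M: "distance_matching n s E d M" "M \<subseteq> s ` {1..<i} \<times> UNIV"
    and i: "i \<in> {1..n}"
  defines "M' \<equiv> greedy_step n s k t E d i M"
  shows "distance_matching n s E d M'" "M' \<subseteq> s ` {1..<Suc i} \<times> UNIV" "M \<subseteq> M'"
    and "(s i, v) \<in> E \<Longrightarrow> s i \<in> fst ` M' \<or> (\<exists>l \<in> {1..<i}. (s l, v) \<in> M' \<and> i < l + d)"
proof -
  let ?C = "greedy_candidates n s k t E d M i"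
  have M': "M' = (if ?C \<noteq> {} then M \<union> {(s i, t (Min ?C))} else M)"
    by (simp add: M'_def greedy_step_def Let_def)
  have fin: "finite ?C"
    by (simp add: greedy_candidates_def)
  show "distance_matching n s E d M'"
  proof (cases "?C = {}")
    case False
    then have "Min ?C \<in> ?C"
      using fin by simp
    then show ?thesis
      using False by (simp add: M' greedy_candidates_def)
  qed (simp add: M' M)
  show "M \<subseteq> M'"
    by (auto simp: M')
  have "s ` {1..<Suc i} = insert (s i) (s ` {1..<i})"
    using i by (simp add: atLeastLessThanSuc)
  then show "M' \<subseteq> s ` {1..<Suc i} \<times> UNIV"
    using M(2) by (auto simp: M')
  assume E: "(s i, v) \<in> E"
  show "s i \<in> fst ` M' \<or> (\<exists>l \<in> {1..<i}. (s l, v) \<in> M' \<and> i < l + d)"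
  proof (cases "?C = {}")
    case True
    \<comment> \<open>Candidates are indices, so emptiness of \<open>?C\<close> applies to
      \<open>v\<close> only through its index \<open>j\<close>.\<close>
    obtain j where j: "j \<in> {1..k}" "v = t j"
      using E G by (auto simp: ordered_bipartite_graph_def)
    then have "\<not> distance_matching n s E d (M \<union> {(s i, v)})"
      using True E by (auto simp: greedy_candidates_def)
    then have "\<exists>l \<in> {1..<i}. (s l, v) \<in> M \<and> \<not> l + d \<le> i"
      using distance_matching_insert[OF G M i E] by blast
    then show ?thesis
      using True by (auto simp: M')
  qed (simp add: M')
qed

text \<open>Loop invariant after \<open>m\<close> rounds. The covering alternative, once established
  at round \<open>i\<close>, persists because later rounds only add edges.\<close>

lemma greedy_fold_props:
  fixes d :: nat
  assumes G: "ordered_bipartite_graph n s k t E" and "m \<le> n"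
  defines "M \<equiv> fold (greedy_step n s k t E d) [1..<Suc m] {}"
  shows "distance_matching n s E d M \<and> M \<subseteq> s ` {1..<Suc m} \<times> UNIV \<and>
    (\<forall>i \<in> {1..m}. \<forall>v. (s i, v) \<in> E \<longrightarrow>
      s i \<in> fst ` M \<or> (\<exists>l \<in> {1..<i}. (s l, v) \<in> M \<and> i < l + d))"
  using \<open>m \<le> n\<close> unfolding M_def
proof (induction m)
  case 0
  show ?case
    by (simp add: distance_matching_iff[OF G])
next
  case (Suc m)
  let ?f = "greedy_step n s k t E d"
  define M where "M = fold ?f [1..<Suc m] {}"
  have IH: "distance_matching n s E d M" "M \<subseteq> s ` {1..<Suc m} \<times> UNIV"
    "\<And>i v. i \<in> {1..m} \<Longrightarrow> (s i, v) \<in> E \<Longrightarrow>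
      s i \<in> fst ` M \<or> (\<exists>l \<in> {1..<i}. (s l, v) \<in> M \<and> i < l + d)"
    using Suc unfolding M_def by auto
  have "Suc m \<in> {1..n}"
    using Suc.prems by simp
  note step = greedy_step_props[OF G IH(1,2) this]
  have fold: "fold ?f [1..<Suc (Suc m)] {} = ?f (Suc m) M"
    by (simp add: M_def)
  have "s i \<in> fst ` ?f (Suc m) M \<or> (\<exists>l \<in> {1..<i}. (s l, v) \<in> ?f (Suc m) M \<and> i < l + d)"
    if "i \<in> {1..Suc m}" "(s i, v) \<in> E" for i v
  proof (cases "i = Suc m")
    case True
    then show ?thesis
      using step(4)[of v] that by blast
  next
    case False
    then have "i \<in> {1..m}"
      using that by simp
    then show ?thesis
      using IH(3)[of i v] that step(3) by blast
  qed
  then show ?case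
    unfolding fold using step(1,2) by blast
qed

theorem theorem8:
  fixes s :: "nat \<Rightarrow> 'a" and t :: "nat \<Rightarrow> 'b" and E :: "('a \<times> 'b) set" and n k d :: nat
  assumes "ordered_bipartite_graph n s k t E"
  shows "distance_matching n s E d (s_greedy n s k t E d) \<and>
    (\<forall>M. distance_matching n s E d M \<longrightarrow> 2 * card (s_greedy n s k t E d) \<ge> card M)"
proof (intro conjI allI impI)
  let ?M = "s_greedy n s k t E d"
  have greedy: "distance_matching n s E d ?M"
    "\<And>i v. i \<in> {1..n} \<Longrightarrow> (s i, v) \<in> E \<Longrightarrow>
      s i \<in> fst ` ?M \<or> (\<exists>l \<in> {1..<i}. (s l, v) \<in> ?M \<and> i < l + d)"
    using greedy_fold_props[OF assms order.refl, of d] unfolding s_greedy_def by blast+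
  show "distance_matching n s E d ?M"
    by (fact greedy(1))
  have E: "E \<subseteq> s ` {1..n} \<times> t ` {1..k}"
    using assms by (simp add: ordered_bipartite_graph_def)
  then have finE: "finite E"
    by (meson finite_SigmaI finite_atLeastAtMost finite_imageI finite_subset)
  then have finM: "finite ?M"
    using greedy(1) by (auto simp: distance_matching_def intro: finite_subset)
  fix M
  assume "distance_matching n s E d M"
  then have M: "M \<subseteq> E" "\<And>u v w. (u, v) \<in> M \<Longrightarrow> (u, w) \<in> M \<Longrightarrow> v = w"
    "\<And>i j v. i \<in> {1..n} \<Longrightarrow> j \<in> {1..n} \<Longrightarrow> i < j \<Longrightarrow> (s i, v) \<in> M \<Longrightarrow> (s j, v) \<in> M \<Longrightarrow> i + d \<le> j"
    unfolding distance_matching_iff[OF assms] by blast+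
  define A where "A = {e \<in> M. fst e \<in> fst ` ?M}"
  \<comment> \<open>Edges are related when they share the first endpoint; \<open>M\<close> has at
    most one edge there.\<close>
  have "card A \<le> card ?M"
    by (rule card_le_if_inj_on_rel[where r = "\<lambda>e f. fst e = fst f"])
      (use finM M(2) in \<open>auto simp: A_def\<close>)
  moreover have "card (M - A) \<le> card ?M"
  \<comment> \<open>A relation avoids choosing one blocking edge for each rejected edge: it suffices
    that no \<open>f\<close> blocks two distinct edges of \<open>M - A\<close>.\<close>
  proof (rule card_le_if_inj_on_rel[OF finM, where r = "\<lambda>e f. \<exists>i v l. e = (s i, v) \<and>
      f = (s l, v) \<and> i \<in> {1..n} \<and> l \<in> {1..<i} \<and> i < l + d"])
    fix e
    assume e: "e \<in> M - A"
    then obtain i v where i: "e = (s i, v)" "i \<in> {1..n}" "(s i, v) \<in> E"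
      using M(1) E by blast
    have "s i \<notin> fst ` ?M"
      using e i(1) by (simp add: A_def)
    with greedy(2)[OF i(2,3)] obtain l where
      "l \<in> {1..<i}" "(s l, v) \<in> ?M" "i < l + d"
      by blast
    with i show "\<exists>f. f \<in> ?M \<and> (\<exists>i v l. e = (s i, v) \<and>
        f = (s l, v) \<and> i \<in> {1..n} \<and> l \<in> {1..<i} \<and> i < l + d)"
      by blast
  next
    fix e e' f
    assume e: "e \<in> M - A" "e' \<in> M - A" and
      "\<exists>i v l. e = (s i, v) \<and> f = (s l, v) \<and> i \<in> {1..n} \<and> l \<in> {1..<i} \<and> i < l + d"
      "\<exists>i v l. e' = (s i, v) \<and> f = (s l, v) \<and> i \<in> {1..n} \<and> l \<in> {1..<i} \<and> i < l + d"
    then obtain i v l j l' where *: "e = (s i, v)" "f = (s l, v)" "i \<in> {1..n}" "l \<in> {1..<i}"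
        "i < l + d" "e' = (s j, v)" "s l = s l'" "j \<in> {1..n}" "l' \<in> {1..<j}" "j < l' + d"
      by auto
    have "l = l'"
      using assms * by (auto simp: ordered_bipartite_graph_def dest!: inj_onD)
    \<comment> \<open>Both \<open>i\<close> and \<open>j\<close> lie strictly between
      \<open>l\<close> and \<open>l + d\<close>, hence differ by less than \<open>d\<close>.\<close>
    then have "\<not> i + d \<le> j" "\<not> j + d \<le> i"
      using * by auto
    then have "i = j"
      using M(3)[of i j v] M(3)[of j i v] * e by (metis DiffD1 nat_neq_iff)
    then show "e = e'"
      using * by simp
  qed
  moreover have "card M = card A + card (M - A)"
    using finite_subset[OF M(1) finE] card_mono[of M A]
    by (auto simp: A_def card_Diff_subset)
  ultimately show "card M \<le> 2 * card ?M"
    by linarith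
qed

end
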